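(* Let $G=(V,E)$ be a $4$-partite graph. Then the set of matchings $M(G)$ of $G$ is the intersection of at most three matroids on $E$.
   Context: Graphs are finite, undirected, without loops or multiple edges. A graph is $4$-partite if its vertex set can be partitioned into $4$ sets $V_1,\dots,V_4$ such that no edge has both endpoints in the same $V_i$. A matroid on a finite set $S$ is a family $\mathcal{M}$ of subsets of $S$ with $\emptyset\in\mathcal{M}$, closed under subsets, such that for every $A\subseteq S$ all maximal members of $\mathcal{M}$ contained in $A$ have the same cardinality. $M(G)$ denotes the family of all matchings of $G$ (sets of pairwise disjoint edges), as a family of subsets of $E$; the intersection of matroids $\mathcal{M}_1,\dots,\mathcal{M}_k$ on $E$ is $\mathcal{M}_1\cap\dots\cap\mathcal{M}_k$. *)

theory Defs
  imports Main "HOL-Library.Disjoint_Sets"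
begin

text \<open>An edge is the two-element set of its endpoints, which excludes loops and multiple edges.\<close>

definition simple_graph :: "'a set \<Rightarrow> 'a set set \<Rightarrow> bool" where
  "simple_graph V E \<longleftrightarrow> finite V \<and> (\<forall>e\<in>E. e \<subseteq> V \<and> card e = 2)"

text \<open>As usual for \<open>k\<close>-partite graphs, parts are allowed to be empty.\<close>

definition k_partite :: "nat \<Rightarrow> 'a set \<Rightarrow> 'a set set \<Rightarrow> bool" where
  "k_partite k V E \<longleftrightarrow>
     (\<exists>P :: nat \<Rightarrow> 'a set.
        (\<Union>i\<in>{1..k}. P i) = V \<and> disjoint_family_on P {1..k} \<and>
        (\<forall>i\<in>{1..k}. \<forall>e\<in>E. \<not> e \<subseteq> P i))"

definition maximal_in :: "'b set set \<Rightarrow> 'b set \<Rightarrow> 'b set \<Rightarrow> bool" where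
  "maximal_in \<M> A B \<longleftrightarrow>
     B \<in> \<M> \<and> B \<subseteq> A \<and> (\<forall>C\<in>\<M>. C \<subseteq> A \<longrightarrow> B \<subseteq> C \<longrightarrow> C = B)"

definition matroid :: "'b set \<Rightarrow> 'b set set \<Rightarrow> bool" where
  "matroid S \<M> \<longleftrightarrow>
     finite S \<and> \<M> \<subseteq> Pow S \<and> {} \<in> \<M> \<and>
     (\<forall>X\<in>\<M>. \<forall>Y. Y \<subseteq> X \<longrightarrow> Y \<in> \<M>) \<and>
     (\<forall>A. A \<subseteq> S \<longrightarrow>
        (\<forall>B C. maximal_in \<M> A B \<longrightarrow> maximal_in \<M> A C \<longrightarrow> card B = card C))"

definition matchings :: "'a set set \<Rightarrow> 'a set set set" where
  "matchings E = {M. M \<subseteq> E \<and> pairwise disjnt M}"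

end

theory Submission
  imports Defs
begin

text \<open>
  Let the parts be \<open>P 1, \<dots>, P 4\<close>. For each \<open>c \<in> {1, 2, 3}\<close> label an edge by its endpoint in \<open>P c\<close>
  if it has one, otherwise by its endpoint in \<open>P 4\<close> if it has one, and otherwise by itself; the
  \<open>c\<close>-th matroid consists of the edge sets with pairwise different labels. Edges with equal labels
  meet. Conversely, two edges meeting in a vertex of \<open>P c\<close>, \<open>c \<le> 3\<close>, have equal \<open>c\<close>-th labels. Two
  edges meeting in a vertex of \<open>P 4\<close> have their other endpoints in at most two of \<open>P 1, P 2, P 3\<close>,
  so their labels agree for a \<open>c\<close> whose part is missed by both.
\<close>

lemma maximal_in_inj_on_image_eq:
  assumes "A \<subseteq> S" and "maximal_in {X. X \<subseteq> S \<and> inj_on f X} A B"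
  shows "f ` B = f ` A"
proof -
  have B: "B \<subseteq> A" "inj_on f B"
    and max: "\<And>C. C \<subseteq> S \<Longrightarrow> inj_on f C \<Longrightarrow> C \<subseteq> A \<Longrightarrow> B \<subseteq> C \<Longrightarrow> C = B"
    using assms(2) by (auto simp: maximal_in_def)
  have "f x \<in> f ` B" if "x \<in> A" for x
  proof (rule ccontr)
    assume x: "f x \<notin> f ` B"
    then have "inj_on f (insert x B)"
      using B by auto
    then have "insert x B = B"
      using max[of "insert x B"] B \<open>x \<in> A\<close> assms(1) by blast
    then show False
      using x by blast
  qed
  then show ?thesis
    using B by blast
qed

lemma matroid_inj_on:
  assumes "finite S"
  shows "matroid S {X. X \<subseteq> S \<and> inj_on f X}"
proof -
  have "card B = card (f ` A)"
    if "A \<subseteq> S" "maximal_in {X. X \<subseteq> S \<and> inj_on f X} A B" for A B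
    using that maximal_in_inj_on_image_eq[OF that] card_image[of f B]
    by (simp add: maximal_in_def)
  then show ?thesis
    using assms by (auto simp: matroid_def intro: inj_on_subset)
qed

text \<open>An endpoint is represented by its singleton, so vertex labels and whole edges share one
  type.\<close>

definition edge_label :: "(nat \<Rightarrow> 'a set) \<Rightarrow> nat \<Rightarrow> 'a set \<Rightarrow> 'a set" where
  "edge_label P c e =
     (if e \<inter> P c \<noteq> {} then e \<inter> P c else if e \<inter> P 4 \<noteq> {} then e \<inter> P 4 else e)"

text \<open>The label of a nonempty edge is a nonempty subset of it, so a common label lies in both
  edges.\<close>

lemma edge_label_eq_imp_meet:
  assumes "edge_label P c e = edge_label P c f" and "e \<noteq> {}"
  shows "e \<inter> f \<noteq> {}"
proof -
  have "edge_label P c e \<subseteq> e" "edge_label P c f \<subseteq> f" "edge_label P c e \<noteq> {}"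
    using assms(2) by (auto simp: edge_label_def)
  then show ?thesis
    using assms(1) by blast
qed

lemma edge_Int_part_eq_singleton:
  assumes "card e = 2" and "\<not> e \<subseteq> Q" and "v \<in> e" and "v \<in> Q"
  shows "e \<inter> Q = {v}"
  using assms by (auto simp: card_2_iff)

text \<open>By disjointness \<open>v\<close> lies in none of the first three parts, and the other
  endpoint lies in at most one of them, whose index serves as \<open>j\<close>.\<close>

lemma edge_misses_two_of_three_parts:
  assumes disj: "disjoint_family_on P {1..4::nat}"
    and e: "card e = 2" and v: "v \<in> e" "v \<in> P 4"
  obtains j where "\<And>c. c \<in> {1..3} \<Longrightarrow> c \<noteq> j \<Longrightarrow> e \<inter> P c = {}"
proof -
  obtain a where a: "e = {v, a}"
    using e v(1) by (auto simp: card_2_iff)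
  have unique: "i = k" if "x \<in> P i" "x \<in> P k" "i \<in> {1..4}" "k \<in> {1..4}" for x i k
    using disj that unfolding disjoint_family_on_def by blast
  have v_notin: "v \<notin> P c" if "c \<in> {1..3}" for c
    using unique[of v c 4] v(2) that by auto
  show ?thesis
  proof (cases "\<exists>j\<in>{1..3}. a \<in> P j")
    case True
    then obtain j where j: "j \<in> {1..3}" "a \<in> P j" by blast
    have "a \<notin> P c" if "c \<in> {1..3}" "c \<noteq> j" for c
      using unique[of a c j] j that by auto
    then show ?thesis
      using that[of j] a v_notin by blast
  next
    case False
    \<comment> \<open>Here all three parts are missed; \<open>0\<close> is a dummy index outside
      \<open>{1..3}\<close>, so it excludes nothing.\<close>
    then show ?thesis
      using that[of 0] a v_notin by blast
  qed
qed

lemma meet_imp_edge_label_eq: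
  assumes disj: "disjoint_family_on P {1..4::nat}"
    and e: "card e = 2" "\<And>i. i \<in> {1..4} \<Longrightarrow> \<not> e \<subseteq> P i"
    and f: "card f = 2" "\<And>i. i \<in> {1..4} \<Longrightarrow> \<not> f \<subseteq> P i"
    and v: "v \<in> e" "v \<in> f" "v \<in> P i" "i \<in> {1..4}"
  obtains c where "c \<in> {1..3}" "edge_label P c e = edge_label P c f"
proof -
  have ef: "e \<inter> P i = {v}" "f \<inter> P i = {v}"
    using e f v by (simp_all add: edge_Int_part_eq_singleton)
  show ?thesis
  proof (cases "i = 4")
    case False
    \<comment> \<open>With \<open>c = i\<close> the first case of the label applies to both edges
      and gives \<open>{v}\<close>.\<close>
    then show ?thesis
      using that[of i] ef v(4) by (auto simp: edge_label_def)
  next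
    case True
    obtain j where j: "\<And>c. c \<in> {1..3} \<Longrightarrow> c \<noteq> j \<Longrightarrow> e \<inter> P c = {}"
      using edge_misses_two_of_three_parts[OF disj e(1) v(1)] v(3) True by blast
    obtain k where k: "\<And>c. c \<in> {1..3} \<Longrightarrow> c \<noteq> k \<Longrightarrow> f \<inter> P c = {}"
      using edge_misses_two_of_three_parts[OF disj f(1) v(2)] v(3) True by blast
    \<comment> \<open>Each edge rules out at most one index, so one of the three remains.\<close>
    have "\<exists>c\<in>{1..3}. c \<noteq> j \<and> c \<noteq> k"
      by (simp add: Bex_def) presburger
    then obtain c where "c \<in> {1..3}" "c \<noteq> j" "c \<noteq> k"
      by blast
    \<comment> \<open>Both edges miss \<open>P c\<close>, so both labels fall through to the second
      case, which gives \<open>{v}\<close>.\<close>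
    then show ?thesis
      using that[of c] j[of c] k[of c] ef True by (simp add: edge_label_def)
  qed
qed

theorem theorem7:
  fixes V :: "'a set" and E :: "'a set set"
  assumes "simple_graph V E"
    and "k_partite 4 V E"
  shows "\<exists>(k::nat) (\<M> :: nat \<Rightarrow> 'a set set set).
           1 \<le> k \<and> k \<le> 3 \<and>
           (\<forall>i\<in>{1..k}. matroid E (\<M> i)) \<and>
           matchings E = (\<Inter>i\<in>{1..k}. \<M> i)"
proof -
  have "finite V" and E: "\<And>e. e \<in> E \<Longrightarrow> e \<subseteq> V" "\<And>e. e \<in> E \<Longrightarrow> card e = 2"
    using assms(1) by (auto simp: simple_graph_def)
  then have "finite E"
    by (meson finite_Pow_iff finite_subset PowI subsetI)
  obtain P :: "nat \<Rightarrow> 'a set" where P: "(\<Union>i\<in>{1..4}. P i) = V" "disjoint_family_on P {1..4}"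
    and indep: "\<And>i e. i \<in> {1..4} \<Longrightarrow> e \<in> E \<Longrightarrow> \<not> e \<subseteq> P i"
    using assms(2) unfolding k_partite_def by blast
  define \<M> where "\<M> c = {X. X \<subseteq> E \<and> inj_on (edge_label P c) X}" for c
  have "X \<in> matchings E \<longleftrightarrow> (\<forall>c\<in>{1..3}. X \<in> \<M> c)" for X
  proof
    assume X: "X \<in> matchings E"
    have "e = f" if "e \<in> X" "f \<in> X" "edge_label P c e = edge_label P c f" for c e f
    proof -
      have "e \<noteq> {}"
        using X E(2)[of e] that(1) by (auto simp: matchings_def)
      then have "\<not> disjnt e f"
        using edge_label_eq_imp_meet[OF that(3)] by (simp add: disjnt_def)
      then show ?thesis
        using X that by (auto simp: matchings_def pairwise_def)
    qed
    then show "\<forall>c\<in>{1..3}. X \<in> \<M> c"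
      using X by (auto simp: \<M>_def matchings_def inj_on_def)
  next
    assume X: "\<forall>c\<in>{1..3}. X \<in> \<M> c"
    from X[rule_format, of 1] have "X \<subseteq> E"
      by (simp add: \<M>_def)
    moreover have "disjnt e f" if ef: "e \<in> X" "f \<in> X" "e \<noteq> f" for e f
    proof (rule ccontr)
      assume "\<not> disjnt e f"
      then obtain v where v: "v \<in> e" "v \<in> f"
        by (auto simp: disjnt_def)
      have "e \<in> E" "f \<in> E"
        using ef \<open>X \<subseteq> E\<close> by auto
      moreover obtain i where "v \<in> P i" "i \<in> {1..4}"
        using E(1)[OF \<open>e \<in> E\<close>] v(1) P(1) by blast
      ultimately obtain c where "c \<in> {1..3}" "edge_label P c e = edge_label P c f"
        using meet_imp_edge_label_eq[OF P(2), of e f v i] E(2) indep v by blast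
      then show False
        using X ef by (auto simp: \<M>_def inj_on_def)
    qed
    ultimately show "X \<in> matchings E"
      by (auto simp: matchings_def pairwise_def)
  qed
  then have "matchings E = (\<Inter>i\<in>{1..3}. \<M> i)"
    by blast
  moreover have "\<forall>i\<in>{1..3}. matroid E (\<M> i)"
    unfolding \<M>_def using matroid_inj_on[OF \<open>finite E\<close>] by blast
  ultimately show ?thesis
    by (intro exI[of _ 3] exI[of _ \<M>]) simp
qed

end
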